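(* Let $0<\nu\le\mu<1$ and $\varsigma\in(0,1]$. For any $\omega>\frac12(1-\nu)$, there exists a univariate function $f_\omega:\mathbb{R}\to\mathbb{R}$ which is continuously differentiable, has a Lipschitz continuous derivative and is bounded below, such that the ASTR1 algorithm with $B_k=0$ for all $k$ and scaling factors satisfying $$\max[\varsigma,v_k]\,(k+1)^\nu\le w_k\le\max[\varsigma,v_k]\,(k+1)^\mu\qquad(k\ge0),$$ where the $v_k$ satisfy, for all $k\geq 0$, $$v_{k+1}>v_k\ \text{ implies that }\ v_{k+1}\le|g_{k+1}|,\qquad\text{and}\qquad v_k\ge\frac{|g_k|}{h(k)}$$ for some positive function $h(k)$ only depending on $k$, applied to $f_\omega$ produces (for a choice of starting point, of scaling factors and of steps allowed by these rules) a sequence of gradients $g_k=f_\omega'(x_k)$ with $$|g_k|=\frac{1}{(k+1)^\omega}\qquad\text{for all }k\ge0.$$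
   Context: ASTR1 algorithm (stated for an objective $f:\mathbb{R}^n\to\mathbb{R}$; used here with $n=1$). Subscript $i,k$ denotes the $i$-th component of a vector at iteration $k$, $\|\cdot\|$ is the Euclidean norm (and induced matrix norm), and $g_k=\nabla f(x_k)$. Given a starting point $x_0\in\mathbb{R}^n$ and constants $\kappa_B\ge1$ and $\tau\in(0,1]$, for $k=0,1,2,\dots$: 1. Compute $g_k$ and define $\Delta_{i,k}=|g_{i,k}|/w_{i,k}$ for $i\in\{1,\dots,n\}$, where the scaling factors $w_{i,k}>0$ depend on $x_0,\dots,x_k$. 2. Select any symmetric matrix $B_k$ with $\|B_k\|\le\kappa_B$. 3. Compute any step $s_k$ such that $|s_{i,k}|\le\Delta_{i,k}$ for all $i\in\{1,\dots,n\}$ and $$g_k^Ts_k+\tfrac12 s_k^TB_ks_k\le\tau\left(g_k^Ts_k^Q+\tfrac12(s_k^Q)^TB_ks_k^Q\right),$$ where $s_{i,k}^L=-\mathrm{sign}(g_{i,k})\Delta_{i,k}$, $s_k^Q=\gamma_ks_k^L$, and $\gamma_k=\min\left[1,\frac{|g_k^Ts_k^L|}{(s_k^L)^TB_ks_k^L}\right]$ if $(s_k^L)^TB_ks_k^L>0$, $\gamma_k=1$ otherwise. 4. Set $x_{k+1}=x_k+s_k$. The algorithm has no termination rule and generates an infinite sequence. *)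

theory Defs
  imports "HOL-Analysis.Analysis"
begin

text \<open>
  Points of n-dimensional Euclidean space are elements of a type of class \<open>euclidean_space\<close>;
  the components of \<open>u\<close> are \<open>u \<bullet> i\<close> for \<open>i \<in> Basis\<close>. For the type \<open>real\<close> one has \<open>Basis = {1}\<close>, so a
  univariate objective is an instance. A matrix is represented by the linear map it induces, and
  its induced norm is \<open>onorm\<close>.
\<close>

definition radius :: "'a::euclidean_space \<Rightarrow> 'a \<Rightarrow> 'a \<Rightarrow> real"
  where "radius g w i = \<bar>g \<bullet> i\<bar> / (w \<bullet> i)"

definition lin_step :: "'a::euclidean_space \<Rightarrow> 'a \<Rightarrow> 'a"
  where "lin_step g w = (\<Sum>i\<in>Basis. (- sgn (g \<bullet> i) * radius g w i) *\<^sub>R i)"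

definition cauchy_coeff :: "'a::euclidean_space \<Rightarrow> 'a \<Rightarrow> ('a \<Rightarrow> 'a) \<Rightarrow> real"
  where "cauchy_coeff g w B =
    (let sL = lin_step g w in
       if sL \<bullet> B sL > 0 then min 1 (\<bar>g \<bullet> sL\<bar> / (sL \<bullet> B sL)) else 1)"

definition quad_step :: "'a::euclidean_space \<Rightarrow> 'a \<Rightarrow> ('a \<Rightarrow> 'a) \<Rightarrow> 'a"
  where "quad_step g w B = cauchy_coeff g w B *\<^sub>R lin_step g w"

definition model :: "'a::euclidean_space \<Rightarrow> ('a \<Rightarrow> 'a) \<Rightarrow> 'a \<Rightarrow> real"
  where "model g B s = g \<bullet> s + (1/2) * (s \<bullet> B s)"

definition ASTR1_step ::
    "real \<Rightarrow> real \<Rightarrow> 'a::euclidean_space \<Rightarrow> 'a \<Rightarrow> ('a \<Rightarrow> 'a) \<Rightarrow> 'a \<Rightarrow> bool"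
  where "ASTR1_step \<kappa>B \<tau> g w B s \<longleftrightarrow>
    (\<forall>i\<in>Basis. w \<bullet> i > 0) \<and>
    linear B \<and> (\<forall>u v. B u \<bullet> v = u \<bullet> B v) \<and> onorm B \<le> \<kappa>B \<and>
    (\<forall>i\<in>Basis. \<bar>s \<bullet> i\<bar> \<le> radius g w i) \<and>
    model g B s \<le> \<tau> * model g B (quad_step g w B)"

text \<open>
  A scaling strategy \<open>W\<close> maps the list of iterates computed so far to the next vector of scaling
  factors, so that the factors used at iteration \<open>k\<close> depend on \<open>x 0, \<dots>, x k\<close> only.
\<close>

definition scaling_factors :: "('a list \<Rightarrow> 'a) \<Rightarrow> (nat \<Rightarrow> 'a) \<Rightarrow> nat \<Rightarrow> 'a"
  where "scaling_factors W x k = W (map x [0..<Suc k])"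

text \<open>
  \<open>ASTR1_run \<kappa>B \<tau> f W B x g s\<close>: the sequences of iterates \<open>x\<close>, gradients \<open>g\<close> and steps \<open>s\<close> can be
  generated by the algorithm on \<open>f\<close>, started at \<open>x 0\<close>, with scaling strategy \<open>W\<close> and matrices \<open>B\<close>.
\<close>

definition ASTR1_run ::
    "real \<Rightarrow> real \<Rightarrow> ('a::euclidean_space \<Rightarrow> real) \<Rightarrow> ('a list \<Rightarrow> 'a) \<Rightarrow> (nat \<Rightarrow> 'a \<Rightarrow> 'a)
      \<Rightarrow> (nat \<Rightarrow> 'a) \<Rightarrow> (nat \<Rightarrow> 'a) \<Rightarrow> (nat \<Rightarrow> 'a) \<Rightarrow> bool"
  where "ASTR1_run \<kappa>B \<tau> f W B x g s \<longleftrightarrow>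
    (\<forall>k. (GDERIV f (x k) :> g k) \<and>
         ASTR1_step \<kappa>B \<tau> (g k) (scaling_factors W x k) (B k) (s k) \<and>
         x (Suc k) = x k + s k)"

definition scaling_rule ::
    "real \<Rightarrow> real \<Rightarrow> real \<Rightarrow> (nat \<Rightarrow> real) \<Rightarrow> (nat \<Rightarrow> real) \<Rightarrow> (nat \<Rightarrow> real) \<Rightarrow> (nat \<Rightarrow> real) \<Rightarrow> bool"
  where "scaling_rule \<nu> \<mu> \<sigma> h g v w \<longleftrightarrow>
    (\<forall>k. max \<sigma> (v k) * (real k + 1) powr \<nu> \<le> w k \<and>
         w k \<le> max \<sigma> (v k) * (real k + 1) powr \<mu> \<and>
         (v (Suc k) > v k \<longrightarrow> v (Suc k) \<le> \<bar>g (Suc k)\<bar>) \<and>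
         v k \<ge> \<bar>g k\<bar> / h k)"

end

theory Submission
  imports Defs
begin

text \<open>
  Take \<open>v\<^sub>k = 1\<close>, \<open>w\<^sub>k = (k+1)\<^sup>\<nu>\<close>, \<open>g\<^sub>k = - (k+1)\<^sup>-\<^sup>\<omega>\<close> and the steps \<open>s\<^sub>k = s\<^sub>k\<^sup>L = (k+1)\<^sup>-\<^sup>\<omega>\<^sup>-\<^sup>\<nu> > 0\<close>, so that the
  iterates increase. Since \<open>\<nu> < 1\<close>, the jumps \<open>\<bar>g\<^sub>k\<^sub>+\<^sub>1 - g\<^sub>k\<bar>\<close> are at most \<open>\<omega> s\<^sub>k\<close>, hence \<open>x\<^sub>k \<mapsto> g\<^sub>k\<close> is
  \<open>\<omega>\<close>-Lipschitz and extends to a Lipschitz function on the line. Its antiderivative loses at most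
  \<open>\<bar>g\<^sub>k\<bar> s\<^sub>k = (k+1)\<^sup>-\<^sup>2\<^sup>\<omega>\<^sup>-\<^sup>\<nu>\<close> between \<open>x\<^sub>k\<close> and \<open>x\<^sub>k\<^sub>+\<^sub>1\<close>, which is summable because \<open>2\<omega> + \<nu> > 1\<close>.
\<close>

lemma antiderivative_exists_UNIV:
  fixes \<phi> :: "real \<Rightarrow> real"
  assumes "continuous_on UNIV \<phi>"
  obtains F where "\<And>t. (F has_real_derivative \<phi> t) (at t)"
proof -
  have "isCont \<phi> t" for t
    using assms by (simp add: continuous_on_eq_continuous_at)
  then obtain F where "\<And>t. (F has_vector_derivative \<phi> t) (at t)"
    using einterval_antiderivative[of "-\<infinity>" "\<infinity>" \<phi>] by auto
  then show ?thesis
    by (intro that) (simp add: has_real_derivative_iff_has_vector_derivative)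
qed

text \<open>
  McShane's extension from below, truncated at 0. Unlike the extension from above, it vanishes
  beyond the limit of the nodes when these converge, so its antiderivative stays bounded there.
\<close>

definition lower_ext :: "real \<Rightarrow> (nat \<Rightarrow> real) \<Rightarrow> (nat \<Rightarrow> real) \<Rightarrow> real \<Rightarrow> real"
  where "lower_ext C x p t = (SUP k. max 0 (p k - C * \<bar>t - x k\<bar>))"

text \<open>The objective will have slope \<open>- p k\<close> at the node \<open>x k\<close>. The
  local bound \<open>p_drop\<close> becomes a global Lipschitz bound because nodes and values are
  monotone.\<close>

context
  fixes C :: real and x p :: "nat \<Rightarrow> real"
  assumes C_nonneg: "0 \<le> C"
    and x_mono: "incseq x"
    and p_nonneg: "\<And>k. 0 \<le> p k"
    and p_antimono: "decseq p"
    and p_drop: "\<And>k. p k - p (Suc k) \<le> C * (x (Suc k) - x k)"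
begin

text \<open>\<open>p_drop\<close> telescopes from \<open>i\<close> to \<open>j\<close>.\<close>

lemma p_lipschitz: "p i - C * (x j - x i) \<le> p j" if "i \<le> j"
  using that
proof (induction j rule: dec_induct)
  case (step j)
  then show ?case using p_drop[of j] by (simp add: algebra_simps)
qed simp

lemma lower_ext_bdd: "bdd_above (range (\<lambda>k. max 0 (p k - C * \<bar>t - x k\<bar>)))"
proof (rule bdd_aboveI2)
  fix k
  have "p k \<le> p 0" using p_antimono by (simp add: decseq_def)
  moreover have "0 \<le> C * \<bar>t - x k\<bar>" using C_nonneg by simp
  ultimately show "max 0 (p k - C * \<bar>t - x k\<bar>) \<le> p 0" using p_nonneg[of 0] by auto
qed

lemma lower_ext_ge: "max 0 (p k - C * \<bar>t - x k\<bar>) \<le> lower_ext C x p t"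
  unfolding lower_ext_def using lower_ext_bdd by (intro cSUP_upper) auto

lemma lower_ext_nonneg: "0 \<le> lower_ext C x p t"
  using lower_ext_ge[of 0 t] by simp

text \<open>The peaks centred at \<open>x n\<close> or at later nodes are no higher than
  \<open>p n\<close>. Those centred earlier have already sunk to \<open>p n\<close> or below at
  \<open>x n\<close>, by \<open>p_lipschitz\<close>.\<close>

lemma lower_ext_le: "lower_ext C x p t \<le> p n" if "x n \<le> t"
  unfolding lower_ext_def
proof (rule cSUP_least)
  fix k
  have nonneg: "0 \<le> C * \<bar>t - x k\<bar>" using C_nonneg by simp
  show "max 0 (p k - C * \<bar>t - x k\<bar>) \<le> p n"
  proof (cases "n \<le> k")
    case True
    then have "p k \<le> p n" using p_antimono by (simp add: decseq_def)
    then show ?thesis using nonneg p_nonneg[of n] by auto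
  next
    case False
    then have "x k \<le> x n" using x_mono by (simp add: incseq_def)
    then have "C * (x n - x k) \<le> C * \<bar>t - x k\<bar>"
      using that C_nonneg by (intro mult_left_mono) auto
    then show ?thesis using p_lipschitz[of k n] False p_nonneg[of n] by auto
  qed
qed simp

lemma lower_ext_node: "lower_ext C x p (x n) = p n"
  using lower_ext_le[of n "x n"] lower_ext_ge[of n "x n"] by simp

text \<open>Every truncated peak is \<open>C\<close>-Lipschitz, and a supremum inherits the common
  constant.\<close>

lemma lower_ext_lipschitz: "C-lipschitz_on UNIV (lower_ext C x p)"
proof -
  have le: "lower_ext C x p t \<le> lower_ext C x p u + C * \<bar>t - u\<bar>" for t u
    unfolding lower_ext_def[of C x p t]
  proof (rule cSUP_least)
    fix k
    have "C * \<bar>u - x k\<bar> \<le> C * (\<bar>t - u\<bar> + \<bar>t - x k\<bar>)"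
      using C_nonneg by (intro mult_left_mono) auto
    moreover have "0 \<le> C * \<bar>t - u\<bar>" using C_nonneg by simp
    ultimately show "max 0 (p k - C * \<bar>t - x k\<bar>) \<le> lower_ext C x p u + C * \<bar>t - u\<bar>"
      using lower_ext_ge[of k u] lower_ext_nonneg[of u] by (simp add: algebra_simps)
  qed simp
  show ?thesis
  proof (rule lipschitz_onI[OF _ C_nonneg])
    fix t u
    show "dist (lower_ext C x p t) (lower_ext C x p u) \<le> C * dist t u"
      using le[of t u] le[of u t] by (simp add: dist_real_def abs_le_iff abs_minus_commute)
  qed
qed

lemma antiderivative_lower_ext_bounded:
  assumes deriv: "\<And>t. (F has_real_derivative lower_ext C x p t) (at t)"
    and lim: "p \<longlonglongrightarrow> 0"
    and summable: "summable (\<lambda>k. p k * (x (Suc k) - x k))"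
  shows "bdd_above (range F)"
proof -
  define S where "S = F (x 0) + (\<Sum>k. p k * (x (Suc k) - x k))"
  have mono: "F t \<le> F u" if "t \<le> u" for t u
    using that deriv lower_ext_nonneg by (meson DERIV_nonneg_imp_nondecreasing)
  \<comment> \<open>Mean value theorem, with the slope to the right of \<open>x n\<close> bounded by
    \<open>lower_ext_le\<close>.\<close>
  have growth: "F t \<le> F (x n) + p n * (t - x n)" if le: "x n \<le> t" for t n
  proof (cases "x n = t")
    case False
    then have "x n < t" using le by simp
    then obtain z where "x n < z" "F t - F (x n) = (t - x n) * lower_ext C x p z"
      using MVT2[of "x n" t F "lower_ext C x p"] deriv by auto
    moreover from this have "(t - x n) * lower_ext C x p z \<le> (t - x n) * p n"
      using le by (intro mult_left_mono lower_ext_le) auto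
    ultimately show ?thesis by (simp add: mult.commute)
  qed simp
  have step_nonneg: "0 \<le> p k * (x (Suc k) - x k)" for k
    using p_nonneg x_mono by (simp add: incseq_Suc_iff)
  have nodes: "F (x n) \<le> S" for n
  proof -
    have "F (x n) \<le> F (x 0) + (\<Sum>k<n. p k * (x (Suc k) - x k))"
    proof (induction n)
      case (Suc n)
      have "x n \<le> x (Suc n)" using x_mono by (simp add: incseq_Suc_iff)
      then show ?case using Suc growth[of n "x (Suc n)"] by simp
    qed simp
    also have "\<dots> \<le> S"
      unfolding S_def using sum_le_suminf[OF summable, of "{..<n}"] step_nonneg by auto
    finally show ?thesis .
  qed
  have "F t \<le> S" for t
  proof (cases "\<exists>n. t \<le> x n")
    case True
    then show ?thesis using mono nodes by (meson order_trans)
  next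
    case False
    \<comment> \<open>Now \<open>t\<close> lies beyond all nodes. Replacing \<open>x n\<close> by
      \<open>x 0\<close> makes the factor of \<open>p n\<close> independent of \<open>n\<close>, so
      this term vanishes in the limit.\<close>
    have "F t \<le> S + p n * (t - x 0)" for n
    proof -
      have "x 0 \<le> x n" using x_mono by (simp add: incseq_def)
      then have "p n * (t - x n) \<le> p n * (t - x 0)"
        using p_nonneg by (intro mult_left_mono) auto
      moreover have "x n \<le> t" using False by (metis nle_le)
      ultimately show ?thesis using growth[of n t] nodes[of n] by linarith
    qed
    moreover have "(\<lambda>n. S + p n * (t - x 0)) \<longlonglongrightarrow> S + 0 * (t - x 0)"
      by (intro tendsto_intros lim)
    ultimately show ?thesis
      using LIMSEQ_le_const by fastforce
  qed
  then show ?thesis by (intro bdd_aboveI2)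
qed

lemma function_with_prescribed_slopes:
  assumes "p \<longlonglongrightarrow> 0"
    and "summable (\<lambda>k. p k * (x (Suc k) - x k))"
  obtains f f' :: "real \<Rightarrow> real"
  where "\<And>t. (f has_real_derivative f' t) (at t)"
    and "C-lipschitz_on UNIV f'" and "bdd_below (range f)" and "\<And>k. f' (x k) = - p k"
proof -
  obtain F where F: "\<And>t. (F has_real_derivative lower_ext C x p t) (at t)"
    using antiderivative_exists_UNIV lipschitz_on_continuous_on[OF lower_ext_lipschitz] by blast
  \<comment> \<open>\<open>F\<close> increases and is bounded above, so its negative has the slopes
    \<open>- p k\<close> and is bounded below.\<close>
  show ?thesis
  proof (rule that[of "\<lambda>t. - F t" "\<lambda>t. - lower_ext C x p t"])
    show "((\<lambda>t. - F t) has_real_derivative - lower_ext C x p t) (at t)" for t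
      using F by (rule DERIV_minus)
    show "C-lipschitz_on UNIV (\<lambda>t. - lower_ext C x p t)"
      using lower_ext_lipschitz by (simp add: lipschitz_on_minus_iff)
    have "bdd_above (range F)"
      using F assms by (rule antiderivative_lower_ext_bounded)
    then obtain M where "F t \<le> M" for t
      by (auto simp: bdd_above_def)
    then show "bdd_below (range (\<lambda>t. - F t))"
      by (intro bdd_belowI2[of _ "- M"]) simp
  qed (simp add: lower_ext_node)
qed

end

text \<open>The graph of the convex function \<open>a powr -\<omega>\<close> lies above its tangent
  at \<open>a\<close>. The proof combines ln(1 + 1/a) \<le> 1/a with 1 + y \<le> exp y.\<close>

lemma powr_minus_drop:
  fixes \<omega> :: real
  assumes "0 < a" and "0 \<le> \<omega>"
  shows "a powr -\<omega> - (a + 1) powr -\<omega> \<le> \<omega> * a powr (-\<omega> - 1)"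
proof -
  have "ln (a + 1) = ln a + ln (1 + 1 / a)"
    using assms ln_mult_pos[of a "1 + 1 / a"] by (simp add: distrib_left add_pos_pos)
  also have "\<dots> \<le> ln a + 1 / a"
    using assms by (intro add_left_mono ln_add_one_self_le_self) simp
  finally have "\<omega> * (ln (a + 1) - ln a) \<le> \<omega> * (1 / a)"
    using assms by (intro mult_left_mono) auto
  then have "1 - \<omega> / a \<le> 1 + - \<omega> * (ln (a + 1) - ln a)" by simp
  also have "\<dots> \<le> exp (- \<omega> * (ln (a + 1) - ln a))"
    by (rule exp_ge_add_one_self)
  finally have "a powr -\<omega> * (1 - \<omega> / a) \<le> a powr -\<omega> * exp (- \<omega> * (ln (a + 1) - ln a))"
    by (intro mult_left_mono) auto
  also have "\<dots> = (a + 1) powr -\<omega>"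
    using assms by (simp add: powr_def exp_add[symmetric] algebra_simps)
  finally show ?thesis
    using assms by (simp add: powr_diff algebra_simps)
qed

text \<open>For the zero matrix \<open>cauchy_coeff\<close> is 1, so \<open>quad_step\<close> is the
  full step \<open>- g / w\<close>. Its model value is \<open>- (g * g / w)\<close>, and
  \<open>\<tau> \<le> 1\<close> gives the decrease condition.\<close>

lemma ASTR1_step_lin_step_real:
  fixes g w :: real
  assumes "0 < w" and "0 \<le> \<kappa>" and "\<tau> \<le> 1"
  shows "ASTR1_step \<kappa> \<tau> g w (\<lambda>u. 0) (- g / w)"
proof -
  have lin: "lin_step g w = - g / w"
    by (simp add: lin_step_def radius_def sgn_if)
  have "g * g / w \<ge> \<tau> * (g * g / w)"
    using assms mult_right_mono[of \<tau> 1 "g * g / w"] by simp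
  then show ?thesis
    using assms
    by (simp add: ASTR1_step_def model_def quad_step_def cauchy_coeff_def lin radius_def
        onorm_zero linear_zero Let_def)
qed

theorem theorem4p3:
  fixes \<nu> \<mu> \<sigma> \<kappa>B \<tau> :: real
  assumes "0 < \<nu>" and "\<nu> \<le> \<mu>" and "\<mu> < 1"
    and "0 < \<sigma>" and "\<sigma> \<le> 1"
    and "1 \<le> \<kappa>B" and "0 < \<tau>" and "\<tau> \<le> 1"
  shows "\<exists>h :: nat \<Rightarrow> real. (\<forall>k. h k > 0) \<and>
    (\<forall>\<omega> > (1 / 2) * (1 - \<nu>).
      \<exists>f :: real \<Rightarrow> real.
        f C1_differentiable_on UNIV \<and>
        (\<exists>L. L-lipschitz_on UNIV (deriv f)) \<and>
        bdd_below (range f) \<and>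
        (\<exists>(W :: real list \<Rightarrow> real) (v :: nat \<Rightarrow> real) (x :: nat \<Rightarrow> real)
          (g :: nat \<Rightarrow> real) (s :: nat \<Rightarrow> real).
          ASTR1_run \<kappa>B \<tau> f W (\<lambda>k u. 0) x g s \<and>
          scaling_rule \<nu> \<mu> \<sigma> h g v (scaling_factors W x) \<and>
          (\<forall>k. g k = deriv f (x k) \<and> \<bar>g k\<bar> = 1 / (real k + 1) powr \<omega>)))"
\<comment> \<open>\<open>h = 1\<close> serves every \<omega> at once, since all gradients have
  modulus at most 1.\<close>
proof (rule exI[of _ "\<lambda>_. 1"], intro conjI allI impI)
  fix \<omega> :: real
  assume "\<omega> > (1 / 2) * (1 - \<nu>)"
  then have \<omega>: "2 * \<omega> + \<nu> > 1" and \<omega>_pos: "\<omega> > 0" using assms by (auto simp: field_simps)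
  define p :: "nat \<Rightarrow> real" where "p k = (real k + 1) powr -\<omega>" for k
  define s :: "nat \<Rightarrow> real" where "s k = (real k + 1) powr (-\<omega> - \<nu>)" for k
  define x :: "nat \<Rightarrow> real" where "x k = (\<Sum>i<k. s i)" for k
  \<comment> \<open>At iteration \<open>k\<close> the list of iterates has length
    \<open>k + 1\<close>.\<close>
  define W :: "real list \<Rightarrow> real" where "W xs = real (length xs) powr \<nu>" for xs
  have x_Suc: "x (Suc k) = x k + s k" for k by (simp add: x_def)
  have W_eq: "scaling_factors W x k = (real k + 1) powr \<nu>" for k
    by (simp add: scaling_factors_def W_def add.commute)
  have "0 \<le> \<omega>"
    using \<omega>_pos by simp
  moreover have "incseq x"
    by (simp add: incseq_Suc_iff x_Suc s_def)
  moreover have "0 \<le> p k" for k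
    by (simp add: p_def)
  moreover have "decseq p"
    using \<omega>_pos by (auto simp: decseq_def p_def intro!: powr_mono2')
  moreover have "p k - p (Suc k) \<le> \<omega> * (x (Suc k) - x k)" for k
  proof -
    have "p k - p (Suc k) \<le> \<omega> * (real k + 1) powr (-\<omega> - 1)"
      using powr_minus_drop[of "real k + 1" \<omega>] \<omega>_pos by (simp add: p_def add_ac)
    \<comment> \<open>Since \<open>\<nu> < 1\<close>, the exponent \<open>-\<omega> - 1\<close> is
      below that of \<open>s k\<close>, and the base is at least 1.\<close>
    also have "\<dots> \<le> \<omega> * s k"
      unfolding s_def using assms \<omega>_pos by (intro mult_left_mono powr_mono) auto
    finally show ?thesis by (simp add: x_Suc)
  qed
  moreover have "p \<longlonglongrightarrow> 0"
  proof -
    have "filterlim (\<lambda>k. real k + 1) at_top sequentially"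
      using filterlim_tendsto_add_at_top[OF tendsto_const[of 1] filterlim_real_sequentially]
      by (simp add: add.commute)
    then show ?thesis
      unfolding p_def using \<omega>_pos by (intro tendsto_neg_powr) auto
  qed
  moreover have "summable (\<lambda>k. p k * (x (Suc k) - x k))"
  proof -
    have "summable (\<lambda>k. real (Suc k) powr (- \<nu> - 2 * \<omega>))"
      using \<omega> by (subst summable_Suc_iff) (simp add: summable_real_powr_iff)
    then show ?thesis
      by (simp add: p_def s_def x_Suc powr_add[symmetric] add.commute)
  qed
  ultimately obtain f f' :: "real \<Rightarrow> real"
    where f: "\<And>t. (f has_real_derivative f' t) (at t)"
      and lip: "\<omega>-lipschitz_on UNIV f'" and bdd: "bdd_below (range f)"
      and slope: "\<And>k. f' (x k) = - p k"
    by (rule function_with_prescribed_slopes) (rule that)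
  have deriv_f: "deriv f = f'" using f by (auto intro: DERIV_imp_deriv)
  have "ASTR1_run \<kappa>B \<tau> f W (\<lambda>k u. 0) x (\<lambda>k. - p k) s"
    unfolding ASTR1_run_def
  proof (intro allI conjI)
    fix k
    show "GDERIV f (x k) :> - p k"
      using f[of "x k"] by (simp add: gderiv_def has_field_derivative_def slope mult_commute_abs)
    have "s k = - (- p k) / scaling_factors W x k"
      by (simp add: W_eq s_def p_def powr_diff)
    then show "ASTR1_step \<kappa>B \<tau> (- p k) (scaling_factors W x k) (\<lambda>u. 0) (s k)"
      using assms ASTR1_step_lin_step_real[of "scaling_factors W x k" \<kappa>B \<tau> "- p k"]
      by (simp add: W_eq)
  qed (rule x_Suc)
  \<comment> \<open>A constant \<open>v\<close> never increases, so the growth condition is vacuous.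
    As \<open>\<sigma> \<le> 1\<close>, the maximum is 1 and \<open>W\<close> attains the lower
    bound.\<close>
  moreover have "scaling_rule \<nu> \<mu> \<sigma> (\<lambda>_. 1) (\<lambda>k. - p k) (\<lambda>_. 1) (scaling_factors W x)"
  proof -
    have "p k \<le> 1" "0 \<le> p k" for k
      using powr_mono2'[of "-\<omega>" 1 "real k + 1"] \<omega>_pos by (auto simp: p_def)
    then show ?thesis
      using assms by (auto simp: scaling_rule_def W_eq max_def intro!: powr_mono)
  qed
  moreover have "f C1_differentiable_on UNIV"
    unfolding C1_differentiable_on_def
    using f lipschitz_on_continuous_on[OF lip] by (auto simp: has_real_derivative_iff_has_vector_derivative)
  moreover have "\<forall>k. - p k = deriv f (x k) \<and> \<bar>- p k\<bar> = 1 / (real k + 1) powr \<omega>"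
    by (auto simp: deriv_f slope p_def powr_minus_divide)
  moreover have "\<omega>-lipschitz_on UNIV (deriv f)"
    using lip by (simp only: deriv_f)
  ultimately show "\<exists>f :: real \<Rightarrow> real.
        f C1_differentiable_on UNIV \<and>
        (\<exists>L. L-lipschitz_on UNIV (deriv f)) \<and>
        bdd_below (range f) \<and>
        (\<exists>(W :: real list \<Rightarrow> real) (v :: nat \<Rightarrow> real) (x :: nat \<Rightarrow> real)
          (g :: nat \<Rightarrow> real) (s :: nat \<Rightarrow> real).
          ASTR1_run \<kappa>B \<tau> f W (\<lambda>k u. 0) x g s \<and>
          scaling_rule \<nu> \<mu> \<sigma> (\<lambda>_. 1) g v (scaling_factors W x) \<and>
          (\<forall>k. g k = deriv f (x k) \<and> \<bar>g k\<bar> = 1 / (real k + 1) powr \<omega>))"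
    using bdd by (intro exI conjI)
qed simp

end
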